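(* Assume the claim sizes are exponentially distributed, $Y_i\sim\exp(\beta)$ with $\beta>0$ (mean $1/\beta$), and that the security loadings $\xi_1(t),\xi_2(t)$ are only required to be non-negative. Fix $t\in[0,T]$. Then there exists a unique pair $(\bar\xi_1,\bar\xi_2)$ of positive numbers such that $$\bar\xi_2=h_1(\bar\xi_1)=h_2(\bar\xi_1),$$ where $h_1$ and $h_2$ (depending on $t$) are the functions defined in the context.
   Context: Constants: $T\in(0,\infty)$, $\beta>0$, $\gamma_I,\gamma_{R1},\gamma_{R2}>0$; the interest rates $\rho_I,\rho_{R1},\rho_{R2}:[0,T]\to(0,\infty)$ are deterministic and bounded. Fix $t\in[0,T]$ and put $$A_k=\gamma_k e^{\int_t^T\rho_k(s)\,ds}\quad(k=I,R1,R2),\qquad C_{R1}=\frac{A_{R1}}{A_I},\qquad C_{R2}=\frac{A_{R2}}{A_I}.$$ For $x>0$ let $$e(x)=\frac{2}{x^2}e^{x}-\left(1+\frac2x+\frac2{x^2}\right),$$ $$g(x)=\frac12\left(-[2C_{R1}-1+x(2C_{R1}+1)]+\sqrt{[2C_{R1}-1+x(2C_{R1}+1)]^2+8C_{R1}(x+1)}\right),\qquad G(x)=g(e(x)).$$ $G$ is continuous and strictly decreasing on $(0,\infty)$; $G^{-1}$ denotes its inverse, defined on the range of $G$. Define $$h_1(\xi_1)=\frac{A_I\,G^{-1}\!\left(A_{R1}/\xi_1\right)}{\beta\left(\frac{A_I}{2\xi_1}+1\right)},$$ for those $\xi_1>0$ such that $A_{R1}/\xi_1$ lies in the range of $G$,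 and $$h_2(\xi_1)=\frac{A_I}{\beta}\left(1+C_{R2}-\frac{A_I}{A_I+2\xi_1}\right),\qquad \xi_1>0.$$ (The relations $\xi_2=h_1(\xi_1)$ and $\xi_2=h_2(\xi_1)$ are the first-order conditions at time $t$ of the optimization problems of reinsurer 1 and reinsurer 2 respectively, for exponential claims.) *)

theory Defs
  imports "HOL-Probability.Probability"
begin

definition accum_coeff :: "real \<Rightarrow> (real \<Rightarrow> real) \<Rightarrow> real \<Rightarrow> real \<Rightarrow> real" where
  "accum_coeff \<gamma> \<rho> T t = \<gamma> * exp (integral {t..T} \<rho>)"

definition e_fun :: "real \<Rightarrow> real" where
  "e_fun x = 2 / x\<^sup>2 * exp x - (1 + 2 / x + 2 / x\<^sup>2)"

text \<open>The parameter \<open>C\<close> stands for the ratio \<open>C_R1 = A_R1 / A_I\<close>.\<close>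

definition g_fun :: "real \<Rightarrow> real \<Rightarrow> real" where
  "g_fun C x = 1 / 2 * (- (2 * C - 1 + x * (2 * C + 1))
      + sqrt ((2 * C - 1 + x * (2 * C + 1))\<^sup>2 + 8 * C * (x + 1)))"

definition G_fun :: "real \<Rightarrow> real \<Rightarrow> real" where
  "G_fun C x = g_fun C (e_fun x)"

text \<open>\<open>G\<close> lives on the open half-line, so its range is the image of \<open>{0<..}\<close>; the inverse
  is meaningful on that range only.\<close>

definition G_range :: "real \<Rightarrow> real set" where
  "G_range C = G_fun C ` {0<..}"

definition G_inv :: "real \<Rightarrow> real \<Rightarrow> real" where
  "G_inv C = the_inv_into {0<..} (G_fun C)"

text \<open>\<open>h1\<close> is a partial function: outside \<open>h1_domain\<close> the value of \<open>h1\<close> is unspecified, so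
  statements about \<open>h1\<close> must carry membership in \<open>h1_domain\<close>.\<close>

definition h1_domain :: "real \<Rightarrow> real \<Rightarrow> real set" where
  "h1_domain A\<^sub>I A\<^sub>R\<^sub>1 = {\<xi>. \<xi> > 0 \<and> A\<^sub>R\<^sub>1 / \<xi> \<in> G_range (A\<^sub>R\<^sub>1 / A\<^sub>I)}"

definition h1 :: "real \<Rightarrow> real \<Rightarrow> real \<Rightarrow> real \<Rightarrow> real" where
  "h1 \<beta> A\<^sub>I A\<^sub>R\<^sub>1 \<xi> = A\<^sub>I * G_inv (A\<^sub>R\<^sub>1 / A\<^sub>I) (A\<^sub>R\<^sub>1 / \<xi>) / (\<beta> * (A\<^sub>I / (2 * \<xi>) + 1))"

definition h2 :: "real \<Rightarrow> real \<Rightarrow> real \<Rightarrow> real \<Rightarrow> real" where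
  "h2 \<beta> A\<^sub>I A\<^sub>R\<^sub>2 \<xi> = A\<^sub>I / \<beta> * (1 + A\<^sub>R\<^sub>2 / A\<^sub>I - A\<^sub>I / (A\<^sub>I + 2 * \<xi>))"

end

theory Submission
  imports Defs
begin

text \<open>
  Eliminate \<open>\<xi>\<^sub>1\<close> in favour of \<open>p = G\<^sup>-\<^sup>1 (A\<^sub>R\<^sub>1 / \<xi>\<^sub>1)\<close>, so that \<open>\<xi>\<^sub>1 = A\<^sub>R\<^sub>1 / G p\<close>. The equation
  \<open>h\<^sub>1 = h\<^sub>2\<close> then becomes the fixed-point equation \<open>p = 1 + C\<^sub>R\<^sub>2 + A\<^sub>R\<^sub>2 / (2 A\<^sub>R\<^sub>1) * G p\<close>. Since \<open>G\<close> is
  continuous and strictly decreasing with values in \<open>(0, 1)\<close>, the right-hand side decreases in \<open>p\<close>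
  and is bounded, so exactly one \<open>p\<close> solves it.
\<close>

text \<open>The subtracted polynomial cancels exactly the first three terms of the exponential
  series. All coefficients that remain are positive, so positivity and strict monotonicity of
  \<open>e_fun\<close> can be read off term by term, without derivatives.\<close>

lemma e_fun_sums:
  assumes "x > 0"
  shows "(\<lambda>n. 2 * x ^ Suc n / fact (n + 3)) sums e_fun x"
proof -
  have "(\<lambda>n. x ^ n / fact n) sums exp x"
    using exp_converges[of x] by (simp add: scaleR_conv_of_real field_simps)
  then have "(\<lambda>n. x ^ (n + 3) / fact (n + 3)) sums (exp x - (\<Sum>i<3. x ^ i / fact i))"
    by (rule sums_split_initial_segment)
  then have "(\<lambda>n. 2 / x\<^sup>2 * (x ^ (n + 3) / fact (n + 3))) sums
      (2 / x\<^sup>2 * (exp x - (\<Sum>i<3. x ^ i / fact i)))"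
    by (rule sums_mult)
  moreover have "2 / x\<^sup>2 * (x ^ (n + 3) / fact (n + 3)) = 2 * x ^ Suc n / fact (n + 3)" for n
    using assms by (simp add: power_add power2_eq_square power3_eq_cube)
  moreover have "2 / x\<^sup>2 * (exp x - (\<Sum>i<3. x ^ i / fact i)) = e_fun x"
    using assms by (simp add: e_fun_def eval_nat_numeral field_simps)
  ultimately show ?thesis by simp
qed

lemma e_fun_pos:
  assumes "x > 0"
  shows "e_fun x > 0"
  using suminf_pos[OF sums_summable[OF e_fun_sums[OF assms]]] assms
  by (simp add: sums_unique[OF e_fun_sums[OF assms]])

lemma e_fun_less:
  assumes "0 < x" "x < y"
  shows "e_fun x < e_fun y"
proof -
  have y: "0 < y" using assms by simp
  have "(\<lambda>n. 2 * y ^ Suc n / fact (n + 3) - 2 * x ^ Suc n / fact (n + 3)) sums (e_fun y - e_fun x)"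
    by (rule sums_diff[OF e_fun_sums[OF y] e_fun_sums[OF assms(1)]])
  moreover have "2 * y ^ Suc n / fact (n + 3) - 2 * x ^ Suc n / fact (n + 3) > 0" for n
    using power_strict_mono[OF assms(2), of "Suc n"] assms(1)
    by (simp add: divide_strict_right_mono del: power_Suc)
  ultimately have "0 < e_fun y - e_fun x"
    using suminf_pos[OF sums_summable] by (metis (no_types, lifting) sums_unique)
  then show ?thesis by simp
qed

text \<open>The radicand exceeds \<open>b\<^sup>2\<close>, so the square root exceeds
  \<open>\<bar>b\<bar>\<close>, whatever the sign of \<open>b\<close>.\<close>

lemma g_fun_pos:
  assumes "C > 0" "x > 0"
  shows "g_fun C x > 0"
proof -
  define b where "b = 2 * C - 1 + x * (2 * C + 1)"
  have "\<bar>b\<bar> = sqrt (b\<^sup>2)" by simp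
  also have "\<dots> < sqrt (b\<^sup>2 + 8 * C * (x + 1))"
    using assms by (intro real_sqrt_less_mono) simp
  finally have "1 / 2 * (- b + sqrt (b\<^sup>2 + 8 * C * (x + 1))) > 0" by simp
  then show ?thesis by (simp only: g_fun_def b_def)
qed

text \<open>The formula for \<open>g_fun\<close> is the larger root of a quadratic. The bounds and
  the monotonicity below work with this equation and positivity instead of the square root.\<close>

lemma g_fun_root:
  assumes "C > 0" "x > 0"
  shows "g_fun C x * (g_fun C x + (2 * C - 1 + x * (2 * C + 1))) = 2 * C * (x + 1)"
proof -
  define b where "b = 2 * C - 1 + x * (2 * C + 1)"
  define r where "r = sqrt (b\<^sup>2 + 8 * C * (x + 1))"
  have r: "r\<^sup>2 = b\<^sup>2 + 8 * C * (x + 1)"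
    unfolding r_def using assms by (intro real_sqrt_pow2) simp
  have g: "g_fun C x = (r - b) / 2"
    by (simp add: g_fun_def r_def b_def)
  have "g_fun C x * (g_fun C x + b) = 2 * C * (x + 1)"
    unfolding g using r by (simp add: power2_eq_square field_simps)
  then show ?thesis by (simp only: b_def)
qed

lemma g_fun_bounds:
  assumes "C > 0" "x > 0"
  shows "g_fun C x < 1" and "2 * C < (2 * C + 1) * g_fun C x"
proof -
  let ?y = "g_fun C x"
  have y: "?y > 0" by (rule g_fun_pos[OF assms])
  \<comment> \<open>At \<open>x = 0\<close> the quadratic has the roots \<open>1\<close> and
    \<open>- 2 * C\<close>. Collecting the terms with \<open>x\<close> on the right makes both
    bounds a comparison of signs.\<close>
  have root: "(?y + 2 * C) * (?y - 1) = x * (2 * C - (2 * C + 1) * ?y)"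
    using g_fun_root[OF assms] by (simp add: algebra_simps)
  show lt: "?y < 1"
  proof (rule ccontr)
    assume "\<not> ?y < 1"
    then have ge: "?y \<ge> 1" by simp
    then have "0 \<le> (?y + 2 * C) * (?y - 1)" using assms by simp
    moreover have "2 * C * 1 \<le> 2 * C * ?y" using ge assms by (intro mult_left_mono) auto
    then have "2 * C - (2 * C + 1) * ?y < 0" using y by (simp add: algebra_simps)
    then have "x * (2 * C - (2 * C + 1) * ?y) < 0" using assms by (simp add: mult_pos_neg)
    ultimately show False using root by simp
  qed
  have "(?y + 2 * C) * (?y - 1) < 0" using y lt assms by (intro mult_pos_neg) auto
  then have "x * (2 * C - (2 * C + 1) * ?y) < 0" using root by simp
  then show "2 * C < (2 * C + 1) * ?y" using assms by (simp add: mult_less_0_iff)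
qed

text \<open>Insert the value \<open>y\<close> at \<open>x\<close> into the quadratic for
  \<open>x'\<close>, whose root is \<open>z\<close>. By the lower bound on \<open>y\<close> the
  result is too large, and this excess factors as \<open>(y - z) * (y + z + b)\<close>.\<close>

lemma g_fun_less:
  assumes "C > 0" "0 < x" "x < x'"
  shows "g_fun C x' < g_fun C x"
proof -
  define y where "y = g_fun C x"
  define z where "z = g_fun C x'"
  define b where "b = 2 * C - 1 + x' * (2 * C + 1)"
  have x': "0 < x'" using assms by simp
  have y: "y > 0" and z: "z > 0"
    unfolding y_def z_def using g_fun_pos assms x' by auto
  have rz: "z * (z + b) = 2 * C * (x' + 1)"
    unfolding z_def b_def by (rule g_fun_root[OF assms(1) x'])
  then have "z * (z + b) > 0" using assms x' by simp
  \<comment> \<open>A positive product with \<open>z > 0\<close> forces \<open>z + b > 0\<close>,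
    although \<open>b\<close> itself may be negative.\<close>
  then have pos: "y + z + b > 0" using y z by (simp add: zero_less_mult_iff)
  have ry: "y * (y + (2 * C - 1 + x * (2 * C + 1))) = 2 * C * (x + 1)"
    unfolding y_def by (rule g_fun_root[OF assms(1,2)])
  have "2 * C < (2 * C + 1) * y"
    unfolding y_def by (rule g_fun_bounds(2)[OF assms(1,2)])
  then have "0 < (x' - x) * ((2 * C + 1) * y - 2 * C)" using assms by simp
  also have "\<dots> = y * (y + b) - z * (z + b)"
    using ry unfolding rz unfolding b_def by (simp add: algebra_simps)
  also have "\<dots> = (y - z) * (y + z + b)" by (simp add: algebra_simps)
  finally have "y - z > 0" using pos by (simp add: zero_less_mult_iff)
  then show ?thesis by (simp add: y_def z_def)
qed

lemma G_fun_pos: "C > 0 \<Longrightarrow> x > 0 \<Longrightarrow> G_fun C x > 0"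
  by (simp add: G_fun_def g_fun_pos e_fun_pos)

lemma G_fun_less_1: "C > 0 \<Longrightarrow> x > 0 \<Longrightarrow> G_fun C x < 1"
  by (simp add: G_fun_def g_fun_bounds(1) e_fun_pos)

lemma G_fun_less: "C > 0 \<Longrightarrow> 0 < x \<Longrightarrow> x < y \<Longrightarrow> G_fun C y < G_fun C x"
  by (simp add: G_fun_def g_fun_less e_fun_pos e_fun_less)

lemma inj_on_G_fun: "C > 0 \<Longrightarrow> inj_on (G_fun C) {0<..}"
  by (rule linorder_inj_onI) (auto dest: G_fun_less)

lemma continuous_on_G_fun: "continuous_on {0<..} (G_fun C)"
  unfolding G_fun_def g_fun_def e_fun_def by (intro continuous_intros) auto

lemma G_inv_eq: "C > 0 \<Longrightarrow> p > 0 \<Longrightarrow> G_inv C (G_fun C p) = p"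
  by (simp add: G_inv_def the_inv_into_f_f inj_on_G_fun)

lemma ex1_G_fun_fixpoint:
  assumes "C > 0" "a > 0" "c > 0"
  shows "\<exists>!p. p > 0 \<and> p = a + c * G_fun C p"
proof (rule ex_ex1I)
  define F where "F p = p - (a + c * G_fun C p)" for p
  \<comment> \<open>As \<open>G_fun C\<close> takes values in (0, 1), every fixed point lies between
    \<open>a\<close> and \<open>a + c\<close>, and \<open>F\<close> changes sign there;
    \<open>a > 0\<close> keeps the interval inside the domain of \<open>G_fun C\<close>.\<close>
  have "continuous_on {a..a + c} F"
    unfolding F_def using assms
    by (intro continuous_intros continuous_on_subset[OF continuous_on_G_fun]) auto
  moreover have "F a \<le> 0"
    using G_fun_pos[OF assms(1,2)] assms by (simp add: F_def)
  moreover have "0 \<le> F (a + c)"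
    using G_fun_less_1[OF assms(1), of "a + c"] assms by (simp add: F_def)
  ultimately obtain p where "a \<le> p" "F p = 0"
    using IVT'[of F a 0 "a + c"] assms by auto
  then show "\<exists>p. p > 0 \<and> p = a + c * G_fun C p"
    using assms by (intro exI[of _ p]) (simp add: F_def)
next
  fix p q
  assume pq: "p > 0 \<and> p = a + c * G_fun C p" "q > 0 \<and> q = a + c * G_fun C q"
  \<comment> \<open>The larger of two fixed points would have the smaller right-hand side.\<close>
  have "\<not> u < v" if "u > 0" "u = a + c * G_fun C u" "v = a + c * G_fun C v" for u v
  proof
    assume "u < v"
    then have "c * G_fun C v < c * G_fun C u"
      using G_fun_less[OF assms(1) \<open>u > 0\<close>] assms by simp
    then show False using that \<open>u < v\<close> by linarith
  qed
  then show "p = q" using pq by (meson linorder_neqE_linordered_idom)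
qed

text \<open>Here \<open>A\<close>, \<open>B\<close>, \<open>D\<close> stand for
  \<open>A\<^sub>I\<close>, \<open>A\<^sub>R\<^sub>1\<close>, \<open>A\<^sub>R\<^sub>2\<close>. At
  \<open>B / y\<close> the inverse in \<open>h1\<close> collapses to \<open>p\<close>, and both
  functions acquire the common denominator \<open>A * y + 2 * B\<close>, which then cancels.\<close>

lemma h1_eq_h2_iff:
  assumes "\<beta> > 0" "A > 0" "B > 0" "D > 0" "p > 0"
  defines "y \<equiv> G_fun (B / A) p"
  shows "h1 \<beta> A B (B / y) = h2 \<beta> A D (B / y) \<longleftrightarrow> p = 1 + D / A + D / (2 * B) * y"
proof -
  have y: "y > 0" unfolding y_def using assms by (intro G_fun_pos) auto
  have p: "G_inv (B / A) y = p" unfolding y_def using assms by (intro G_inv_eq) auto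
  have d: "A * y + 2 * B > 0" using y assms by (simp add: add_pos_pos)
  have "h1 \<beta> A B (B / y) = A / \<beta> * (2 * B * p / (A * y + 2 * B))"
    using y d assms(1-5) by (simp add: h1_def p field_simps)
  moreover have "h2 \<beta> A D (B / y) = A / \<beta> * ((1 + D / A) - A * y / (A * y + 2 * B))"
    using y d assms(1-5) by (simp add: h2_def divide_simps)
  moreover have "(1 + D / A) - A * y / (A * y + 2 * B) =
      2 * B * (1 + D / A + D / (2 * B) * y) / (A * y + 2 * B)"
    using d assms(1-5) by (simp add: divide_simps) (simp add: algebra_simps)
  ultimately have "h1 \<beta> A B (B / y) = h2 \<beta> A D (B / y) \<longleftrightarrow>
      2 * B * p / (A * y + 2 * B) = 2 * B * (1 + D / A + D / (2 * B) * y) / (A * y + 2 * B)"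
    using assms(1,2) by (simp only: mult_cancel_left) simp
  also have "\<dots> \<longleftrightarrow> p = 1 + D / A + D / (2 * B) * y"
    using d assms(1-5) by (simp only: divide_cancel_right mult_cancel_left) simp
  finally show ?thesis .
qed

text \<open>At a solution \<open>h1\<close> and \<open>h2\<close> agree, so this gives \<xi>2 > 0
  without estimating \<open>G_inv\<close>.\<close>

lemma h2_pos:
  assumes "\<beta> > 0" "A > 0" "D > 0" "\<xi> > 0"
  shows "h2 \<beta> A D \<xi> > 0"
proof -
  have "A / (A + 2 * \<xi>) < 1" "D / A > 0" using assms by auto
  then have "1 + D / A - A / (A + 2 * \<xi>) > 0" by linarith
  then show ?thesis using assms by (simp add: h2_def)
qed

lemma ex1_equilibrium:
  assumes "\<beta> > 0" "A > 0" "B > 0" "D > 0"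
  shows "\<exists>!\<xi>. \<xi> \<in> h1_domain A B \<and> h1 \<beta> A B \<xi> = h2 \<beta> A D \<xi>"
proof -
  define C where "C = B / A"
  have C: "C > 0" using assms by (simp add: C_def)
  \<comment> \<open>Parametrizing the domain by \<open>p\<close> turns the equation for \<xi> into
    one for \<open>p\<close>; since \<open>p\<close> determines \<xi>, uniqueness carries
    over.\<close>
  have dom: "\<xi> \<in> h1_domain A B \<longleftrightarrow> (\<exists>p>0. \<xi> = B / G_fun C p)" for \<xi>
  proof
    assume "\<xi> \<in> h1_domain A B"
    then obtain p where "\<xi> > 0" "p > 0" "B / \<xi> = G_fun C p"
      unfolding h1_domain_def G_range_def C_def by auto
    then show "\<exists>p>0. \<xi> = B / G_fun C p"
      using assms G_fun_pos[OF C, of p] by (intro exI[of _ p]) (simp add: field_simps)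
  next
    assume "\<exists>p>0. \<xi> = B / G_fun C p"
    then obtain p where "p > 0" "\<xi> = B / G_fun C p" by blast
    then show "\<xi> \<in> h1_domain A B"
      using assms G_fun_pos[OF C, of p] unfolding h1_domain_def G_range_def C_def by auto
  qed
  have "\<exists>!p. p > 0 \<and> p = (1 + D / A) + D / (2 * B) * G_fun C p"
    using assms by (intro ex1_G_fun_fixpoint C) (auto intro: add_pos_pos)
  then have "\<exists>!p. p > 0 \<and> h1 \<beta> A B (B / G_fun C p) = h2 \<beta> A D (B / G_fun C p)"
    using h1_eq_h2_iff[OF assms] unfolding C_def by (metis (no_types, lifting))
  then show ?thesis
    unfolding dom by (metis (no_types, lifting))
qed

lemma accum_coeff_pos: "\<gamma> > 0 \<Longrightarrow> accum_coeff \<gamma> \<rho> T t > 0"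
  by (simp add: accum_coeff_def)

theorem proposition4p1:
  fixes M :: "'a measure" and Y :: "nat \<Rightarrow> 'a \<Rightarrow> real"
    and T t \<beta> \<gamma>\<^sub>I \<gamma>\<^sub>R\<^sub>1 \<gamma>\<^sub>R\<^sub>2 A\<^sub>I A\<^sub>R\<^sub>1 A\<^sub>R\<^sub>2 :: real
    and \<rho>\<^sub>I \<rho>\<^sub>R\<^sub>1 \<rho>\<^sub>R\<^sub>2 :: "real \<Rightarrow> real"
  assumes "T > 0" and "t \<in> {0..T}"
    and "\<beta> > 0" and "\<gamma>\<^sub>I > 0" and "\<gamma>\<^sub>R\<^sub>1 > 0" and "\<gamma>\<^sub>R\<^sub>2 > 0"
    and "\<And>\<rho>. \<rho> \<in> {\<rho>\<^sub>I, \<rho>\<^sub>R\<^sub>1, \<rho>\<^sub>R\<^sub>2} \<Longrightarrow>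
           (\<forall>s\<in>{0..T}. \<rho> s > 0) \<and> bounded (\<rho> ` {0..T}) \<and> \<rho> integrable_on {0..T}"
    and "prob_space M"
    and "\<And>i. distributed M lborel (Y i) (exponential_density \<beta>)"
    and "A\<^sub>I = accum_coeff \<gamma>\<^sub>I \<rho>\<^sub>I T t"
    and "A\<^sub>R\<^sub>1 = accum_coeff \<gamma>\<^sub>R\<^sub>1 \<rho>\<^sub>R\<^sub>1 T t"
    and "A\<^sub>R\<^sub>2 = accum_coeff \<gamma>\<^sub>R\<^sub>2 \<rho>\<^sub>R\<^sub>2 T t"
  shows "\<exists>!\<xi>. case \<xi> of (\<xi>\<^sub>1, \<xi>\<^sub>2) \<Rightarrow>
           \<xi>\<^sub>1 > 0 \<and> \<xi>\<^sub>2 > 0 \<and> \<xi>\<^sub>1 \<in> h1_domain A\<^sub>I A\<^sub>R\<^sub>1 \<and>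
           \<xi>\<^sub>2 = h1 \<beta> A\<^sub>I A\<^sub>R\<^sub>1 \<xi>\<^sub>1 \<and> h1 \<beta> A\<^sub>I A\<^sub>R\<^sub>1 \<xi>\<^sub>1 = h2 \<beta> A\<^sub>I A\<^sub>R\<^sub>2 \<xi>\<^sub>1"
proof -
  have A: "A\<^sub>I > 0" "A\<^sub>R\<^sub>1 > 0" "A\<^sub>R\<^sub>2 > 0"
    using assms by (simp_all add: accum_coeff_pos)
  obtain \<xi> where \<xi>: "\<xi> \<in> h1_domain A\<^sub>I A\<^sub>R\<^sub>1" "h1 \<beta> A\<^sub>I A\<^sub>R\<^sub>1 \<xi> = h2 \<beta> A\<^sub>I A\<^sub>R\<^sub>2 \<xi>"
    and unique: "\<And>\<eta>. \<eta> \<in> h1_domain A\<^sub>I A\<^sub>R\<^sub>1 \<Longrightarrow> h1 \<beta> A\<^sub>I A\<^sub>R\<^sub>1 \<eta> = h2 \<beta> A\<^sub>I A\<^sub>R\<^sub>2 \<eta> \<Longrightarrow> \<eta> = \<xi>"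
    using ex1_equilibrium[OF \<open>\<beta> > 0\<close> A] by blast
  have "\<xi> > 0" using \<xi> by (simp add: h1_domain_def)
  then have "h2 \<beta> A\<^sub>I A\<^sub>R\<^sub>2 \<xi> > 0" using \<open>\<beta> > 0\<close> A by (intro h2_pos)
  with \<open>\<xi> > 0\<close> \<xi> show ?thesis
    \<comment> \<open>The second component is written with \<open>h2\<close> so that its positivity
      is at hand. For any other solution \<open>unique\<close> fixes the first component, and the
      equations then fix the second.\<close>
    by (intro ex1I[of _ "(\<xi>, h2 \<beta> A\<^sub>I A\<^sub>R\<^sub>2 \<xi>)"]) (auto dest: unique)
qed

end
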